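(* Let $T$ be a tree of order $n \geq 2$ with diameter $d$ and with $p$ pendant vertices (with the convention that $p=1$ when $n=2$). Let $\operatorname{indmat}(T)$ denote the induced matching number of $T$. Then $$\left\lfloor \frac{n-p+d+5}{6} \right\rfloor \leq \operatorname{indmat}(T) \leq \min\left\{n-p, \left\lfloor \frac{2n-p}{3} \right\rfloor\right\}.$$
   Context: All graphs are finite and simple. A tree is a connected acyclic graph; its order is its number of vertices. The diameter of a graph is the maximum distance between two of its vertices. A pendant vertex is a vertex of degree one. Convention: the tree with two vertices is regarded as the star $\mathcal{S}_1$ consisting of one central vertex and one pendant vertex, so $p=1$ for it; for $n\ge 3$, $p$ is the number of vertices of degree one. A matching in a graph is a set of pairwise disjoint edges; it is induced if no two of its edges are connected by an edge of the graph. The induced matching number $\operatorname{indmat}(G)$ (also written $\operatorname{im}(G)$) is the maximum size of an induced matching in $G$. *)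

theory Defs
  imports "Graph_Theory.Graph_Theory"
begin

text \<open>
  A finite simple graph is a \<^locale>\<open>pair_graph\<close>: a finite, loop-free digraph whose arc relation is
  symmetric, each undirected edge being represented by its two opposite arcs. All notions below
  are meant for such graphs.

  The library's \<^const>\<open>tree\<close> is not usable here: in a symmetric digraph the closed walk \<open>u, v, u\<close> counts
  as a \<open>cycle\<close>, so no graph with an edge would be a \<^const>\<open>forest\<close>. The cycles of the undirected graph
  are exactly the cycles of the symmetric digraph having length at least 3.
\<close>

definition acyclic_graph :: "'a pair_pre_digraph \<Rightarrow> bool" where
  "acyclic_graph G \<longleftrightarrow> \<not> (\<exists>c. pre_digraph.cycle (with_proj G) c \<and> length c \<ge> 3)"

definition tree_graph :: "'a pair_pre_digraph \<Rightarrow> bool" where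
  "tree_graph G \<longleftrightarrow>
     pair_graph G \<and> Digraph_Component.connected (with_proj G) \<and> acyclic_graph G"

definition graph_dist :: "'a pair_pre_digraph \<Rightarrow> 'a \<Rightarrow> 'a \<Rightarrow> nat" where
  "graph_dist G u v = (LEAST k. \<exists>w. pre_digraph.awalk (with_proj G) u w v \<and> length w = k)"

definition graph_diameter :: "'a pair_pre_digraph \<Rightarrow> nat" where
  "graph_diameter G = Max {graph_dist G u v | u v. u \<in> pverts G \<and> v \<in> pverts G}"

text \<open>
  In a symmetric digraph the out-degree of a vertex is its degree in the undirected graph.
\<close>

definition pendant_vertices :: "'a pair_pre_digraph \<Rightarrow> 'a set" where
  "pendant_vertices G = {v \<in> pverts G. out_degree (with_proj G) v = 1}"

text \<open>
  The tree with two vertices is regarded as a star with one central and one pendant vertex.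
\<close>

definition num_pendant :: "'a pair_pre_digraph \<Rightarrow> nat" where
  "num_pendant G = (if card (pverts G) = 2 then 1 else card (pendant_vertices G))"

definition edges :: "'a pair_pre_digraph \<Rightarrow> 'a set set" where
  "edges G = {{u, v} | u v. (u, v) \<in> parcs G}"

definition matching :: "'a pair_pre_digraph \<Rightarrow> 'a set set \<Rightarrow> bool" where
  "matching G M \<longleftrightarrow> M \<subseteq> edges G \<and> (\<forall>e\<in>M. \<forall>f\<in>M. e \<noteq> f \<longrightarrow> e \<inter> f = {})"

definition induced_matching :: "'a pair_pre_digraph \<Rightarrow> 'a set set \<Rightarrow> bool" where
  "induced_matching G M \<longleftrightarrow>
     matching G M \<and>
     (\<forall>e\<in>M. \<forall>f\<in>M. e \<noteq> f \<longrightarrow> \<not> (\<exists>u\<in>e. \<exists>v\<in>f. {u, v} \<in> edges G))"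

definition indmat :: "'a pair_pre_digraph \<Rightarrow> nat" where
  "indmat G = Max {card M | M. induced_matching G M}"

end

theory Submission
  imports Defs
begin

text \<open>
  Write \<open>q\<close> for the number of vertices of degree at least two, so that \<open>q = n - p\<close> when \<open>n \<ge> 3\<close>,
  and \<open>m\<close> for the induced matching number.

  Lower bound. Root the tree at a pendant vertex. Exactly the pendant vertices other than the
  root have no child, so \<open>q + 1\<close> vertices have one. Fix a residue \<open>c\<close> modulo 3 and join each vertex
  of depth congruent to \<open>c\<close> that has a child to one chosen child. Endpoints of these edges have
  depths congruent to \<open>c\<close> or \<open>c + 1\<close>, and adjacent vertices of a tree differ in depth by exactly
  one; hence an edge of the tree between two of them joins a vertex to a child of its own, and the
  chosen edges form an induced matching (\<open>parents_mod_3_le_indmat\<close>). The three residues together use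
  up all \<open>q + 1\<close> vertices that have a child, whence \<open>q + 1 \<le> 3 m\<close> (\<open>indmat_lower_bound\<close>). The inner
  vertices of a longest path have degree at least two, whence \<open>d \<le> q + 1\<close>
  (\<open>diameter_le_card_non_pendant\<close>). Adding up, \<open>q + d + 1 \<le> 2 q + 2 \<le> 6 m\<close>, while the floor
  asks for \<open>n - p + d \<le> 6 m\<close>; here \<open>n - p\<close> is \<open>q\<close> for \<open>n \<ge> 3\<close> and \<open>q + 1\<close> for \<open>n = 2\<close>.

  Upper bound. The edges of a matching are disjoint, so \<open>2 m \<le> n\<close>. If \<open>n \<ge> 3\<close>, two pendant
  vertices are never adjacent, so each edge contains one of the \<open>n - p\<close> other vertices and
  \<open>m \<le> n - p\<close>; for \<open>n = 2\<close> this says \<open>m \<le> 1\<close>. The sum of the two inequalities is \<open>3 m \<le> 2 n - p\<close>.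
\<close>

section \<open>Distances to a root of a tree\<close>

text \<open>
  These congruences are isolated so that the arithmetic is decided on plain variables rather
  than on distances.
\<close>

lemma Suc_mod_3_neq: "Suc a mod 3 \<noteq> a mod 3"
  by presburger

lemma mod_Suc_cong_3: "a mod 3 = b mod 3 \<Longrightarrow> Suc a mod 3 = Suc b mod 3"
  by presburger

locale undirected_tree = pair_graph T for T :: "'a pair_pre_digraph" +
  assumes connected: "Digraph_Component.connected (with_proj T)"
    and acyclic: "acyclic_graph T"
begin

abbreviation depth :: "'a \<Rightarrow> 'a \<Rightarrow> nat" where
  "depth r v \<equiv> graph_dist T v r"

lemma walk_exists:
  assumes "u \<in> pverts T" "v \<in> pverts T"
  shows "\<exists>p. awalk u p v"
proof -
  have "strongly_connected (with_proj T)"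
    using pair_sym_arcs connected by (rule symmetric_connected_imp_strongly_connected)
  then have "u \<rightarrow>\<^sup>*\<^bsub>with_proj T\<^esub> v"
    using assms by (auto simp: strongly_connected_def)
  then show ?thesis by (simp add: reachable_awalk)
qed

lemma shortest_walk:
  assumes "v \<in> pverts T" "r \<in> pverts T"
  obtains p where "awalk v p r" "length p = depth r v"
proof -
  have "\<exists>k p. awalk v p r \<and> length p = k" using walk_exists[OF assms] by blast
  then have "\<exists>p. awalk v p r \<and> length p = depth r v"
    unfolding graph_dist_def by (rule LeastI_ex)
  then show ?thesis using that by blast
qed

lemma depth_le_length: "awalk v p r \<Longrightarrow> depth r v \<le> length p"
  unfolding graph_dist_def by (rule Least_le) blast

lemma depth_root: "r \<in> pverts T \<Longrightarrow> depth r r = 0"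
  using depth_le_length[of r "[]" r] by (simp add: awalk_Nil_iff)

lemma depth_eq_0: "v \<in> pverts T \<Longrightarrow> r \<in> pverts T \<Longrightarrow> depth r v = 0 \<Longrightarrow> v = r"
  by (metis shortest_walk length_0_conv awalk_empty_ends)

lemma depth_neighbour_le:
  assumes "(v, u) \<in> parcs T" "r \<in> pverts T"
  shows "depth r v \<le> Suc (depth r u)"
proof -
  obtain p where p: "awalk u p r" "length p = depth r u"
    using shortest_walk[OF in_arcsD2[OF assms(1)] assms(2)] .
  then have "awalk v ((v, u) # p) r" using assms(1) by (simp add: awalk_Cons_iff)
  from depth_le_length[OF this] p(2) show ?thesis by simp
qed

lemma parent_exists:
  assumes "v \<in> pverts T" "r \<in> pverts T" "v \<noteq> r"
  obtains u where "(v, u) \<in> parcs T" "depth r v = Suc (depth r u)"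
proof -
  obtain p where p: "awalk v p r" "length p = depth r v"
    using shortest_walk[OF assms(1,2)] .
  with assms(3) obtain e q where pe: "p = e # q" by (cases p) (auto simp: awalk_Nil_iff)
  obtain u where e: "e = (v, u)" using p(1) pe by (cases e) (auto simp: awalk_Cons_iff)
  have arc: "(v, u) \<in> parcs T" and q: "awalk u q r"
    using p(1) unfolding pe e by (simp_all add: awalk_Cons_iff)
  have "Suc (depth r u) \<le> depth r v" using depth_le_length[OF q] p(2) pe by simp
  then show ?thesis using that[OF arc] depth_neighbour_le[OF arc assms(2)] by simp
qed

text \<open>
  Following parents up to the root yields a walk that meets no vertex as deep as its start,
  except the start itself. This is what keeps the walks in the cycle argument below away from a
  given vertex.
\<close>

lemma descending_walk:
  assumes "v \<in> pverts T" "r \<in> pverts T"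
  shows "\<exists>p. awalk v p r \<and> (\<forall>w \<in> set (pawalk_verts v p). w = v \<or> depth r w < depth r v)"
  using assms(1)
proof (induction "depth r v" arbitrary: v)
  case 0
  then have "v = r" using depth_eq_0 assms(2) by simp
  then show ?case using assms(2) by (intro exI[of _ "[]"]) (simp add: awalk_Nil_iff)
next
  case (Suc k)
  then have "v \<noteq> r" using depth_root assms(2) by force
  then obtain u where u: "(v, u) \<in> parcs T" "depth r v = Suc (depth r u)"
    using parent_exists[OF Suc.prems assms(2)] by blast
  then obtain p where p: "awalk u p r"
      "\<forall>w \<in> set (pawalk_verts u p). w = u \<or> depth r w < depth r u"
    using Suc.hyps in_arcsD2 by fastforce
  have "awalk v ((v, u) # p) r" using u(1) p(1) by (simp add: awalk_Cons_iff)
  moreover have "\<forall>w \<in> set (pawalk_verts v ((v, u) # p)). w = v \<or> depth r w < depth r v"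
    using p(2) u(2) by auto
  ultimately show ?case by blast
qed

text \<open>
  The only place where acyclicity enters: a walk between two neighbours of \<open>v\<close> that misses \<open>v\<close>
  contains a path, which closes up through \<open>v\<close> to a cycle. The cycle has length at least 3 because
  the two neighbours are distinct.
\<close>

lemma no_detour:
  assumes "(v, x) \<in> parcs T" "(v, y) \<in> parcs T" "x \<noteq> y"
    and "awalk x p y"
  shows "v \<in> set (pawalk_verts x p)"
proof (rule ccontr)
  assume v: "v \<notin> set (pawalk_verts x p)"
  define c where "c = awalk_to_apath p"
  have c: "apath x c y" unfolding c_def using assms(4) by (rule apath_awalk_to_apath)
  then have aw: "awalk x c y" and dist: "distinct (pawalk_verts x c)"
    by (simp_all add: apath_def)
  have "set c \<subseteq> set p" unfolding c_def using assms(4) by (rule awalk_to_apath_subset)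
  then have "set (pawalk_verts x c) \<subseteq> set (pawalk_verts x p)"
    using set_awalk_verts[OF aw] set_awalk_verts[OF assms(4)] by auto
  with v have vc: "v \<notin> set (pawalk_verts x c)" by blast
  have "c \<noteq> []" using aw assms(3) by (auto simp: awalk_Nil_iff)
  let ?C = "(v, x) # c @ [(y, v)]"
  have yv: "awalk y [(y, v)] v"
    using assms(2) arcs_symmetric in_arcsD1 by (simp add: awalk_simps)
  have aw': "awalk x (c @ [(y, v)]) v" using aw yv by (rule awalk_appendI)
  then have "awalk v ?C v" using assms(1) by (simp add: awalk_Cons_iff del: awalk_append_iff)
  moreover have "distinct (tl (pawalk_verts v ?C))"
    using awalk_verts_append[OF aw'] dist vc by simp
  ultimately have "cycle ?C" unfolding cycle_def by blast
  moreover have "length ?C \<ge> 3" using \<open>c \<noteq> []\<close> by (cases c) auto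
  ultimately show False using acyclic unfolding acyclic_graph_def by blast
qed

text \<open>
  Going up from \<open>x\<close> to the root and down again to \<open>y\<close> along descending walks would be a detour
  around \<open>v\<close>. Allowing equality of depths lets the same argument exclude edges inside a level.
\<close>

lemma lower_neighbour_unique:
  assumes "r \<in> pverts T"
    and x: "(v, x) \<in> parcs T" "depth r x \<le> depth r v"
    and y: "(v, y) \<in> parcs T" "depth r y \<le> depth r v"
  shows "x = y"
proof (rule ccontr)
  assume "x \<noteq> y"
  obtain p where p: "awalk x p r"
      "\<forall>w \<in> set (pawalk_verts x p). w = x \<or> depth r w < depth r x"
    using descending_walk[OF in_arcsD2[OF x(1)] assms(1)] by blast
  obtain q where q: "awalk y q r"
      "\<forall>w \<in> set (pawalk_verts y q). w = y \<or> depth r w < depth r y"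
    using descending_walk[OF in_arcsD2[OF y(1)] assms(1)] by blast
  have rq: "awalk r (rev_path q) y" using q(1) by simp
  have "awalk x (p @ rev_path q) y" using p(1) rq by (rule awalk_appendI)
  from no_detour[OF x(1) y(1) \<open>x \<noteq> y\<close> this]
  have "v \<in> set (pawalk_verts x p) \<union> set (pawalk_verts y q)"
    using set_awalk_verts_append[OF p(1) rq] awalk_verts_rev_path[OF q(1)] by simp
  then show False using p(2) q(2) x y no_loops' by fastforce
qed

text \<open>
  The distance function changes by at most one along an edge; it cannot stay constant, since
  the neighbour on the same level and the parent would be two lower neighbours.
\<close>

lemma neighbour_depth:
  assumes "(u, v) \<in> parcs T" "r \<in> pverts T"
  shows "depth r u = Suc (depth r v) \<or> depth r v = Suc (depth r u)"
proof (rule ccontr)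
  assume neg: "\<not> ?thesis"
  have vu: "(v, u) \<in> parcs T" using assms(1) by (rule arcs_symmetric)
  have eq: "depth r u = depth r v"
    using neg depth_neighbour_le[OF assms] depth_neighbour_le[OF vu assms(2)] by linarith
  have V: "u \<in> pverts T" "v \<in> pverts T" using in_arcsD1 assms(1) vu by blast+
  have "u \<noteq> r"
    using eq depth_root[OF assms(2)] depth_eq_0[OF V(2) assms(2)] no_loops'[OF assms(1)] by auto
  then obtain x where x: "(u, x) \<in> parcs T" "depth r u = Suc (depth r x)"
    using parent_exists[OF V(1) assms(2)] by blast
  have "x = v"
    by (rule lower_neighbour_unique[OF assms(2) x(1) _ assms(1)]) (simp_all add: x(2) flip: eq)
  then show False using x(2) eq by simp
qed

lemma neighbour_depth_mod_3:
  assumes "(u, v) \<in> parcs T" "r \<in> pverts T"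
  shows "depth r u mod 3 \<noteq> depth r v mod 3"
  using neighbour_depth[OF assms] Suc_mod_3_neq by metis

section \<open>Degrees\<close>

lemma out_degree_eq_card_neighbours:
  "out_degree (with_proj T) v = card {w. (v, w) \<in> parcs T}"
proof -
  have "out_arcs (with_proj T) v = Pair v ` {w. (v, w) \<in> parcs T}"
    by (auto simp: out_arcs_def)
  then show ?thesis by (simp add: out_degree_def card_image inj_on_def)
qed

lemma pendant_iff_unique_neighbour:
  "v \<in> pendant_vertices T \<longleftrightarrow> v \<in> pverts T \<and> (\<exists>!w. (v, w) \<in> parcs T)"
proof -
  have "card {w. (v, w) \<in> parcs T} = 1 \<longleftrightarrow> (\<exists>w. {w. (v, w) \<in> parcs T} = {w})"
    by (simp add: card_1_singleton_iff)
  also have "\<dots> \<longleftrightarrow> (\<exists>w. \<forall>x. (v, x) \<in> parcs T \<longleftrightarrow> x = w)"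
    by (simp add: set_eq_iff)
  also have "\<dots> \<longleftrightarrow> (\<exists>!w. (v, w) \<in> parcs T)"
    unfolding Ex1_def by (intro arg_cong[where f = Ex] ext) auto
  finally show ?thesis
    by (simp only: pendant_vertices_def out_degree_eq_card_neighbours mem_Collect_eq)
qed

lemma pendant_subset: "pendant_vertices T \<subseteq> pverts T"
  by (auto simp: pendant_vertices_def)

definition parents :: "'a \<Rightarrow> 'a set" where
  "parents r = {u \<in> pverts T. \<exists>v. (u, v) \<in> parcs T \<and> depth r v = Suc (depth r u)}"

text \<open>
  Only one neighbour is the parent, so a second neighbour must lie below.
\<close>

lemma non_pendant_is_parent:
  assumes "v \<in> pverts T" "r \<in> pverts T" "v \<noteq> r" "v \<notin> pendant_vertices T"
  shows "v \<in> parents r"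
proof -
  obtain u where u: "(v, u) \<in> parcs T" "depth r v = Suc (depth r u)"
    using parent_exists[OF assms(1-3)] .
  then obtain w where w: "(v, w) \<in> parcs T" "w \<noteq> u"
    using assms(1,4) unfolding pendant_iff_unique_neighbour by blast
  then have "\<not> depth r w \<le> depth r v"
    using lower_neighbour_unique[OF assms(2) w(1) _ u(1)] u(2) by auto
  then have "depth r w = Suc (depth r v)" using neighbour_depth[OF w(1) assms(2)] by linarith
  then show ?thesis using w(1) assms(1) by (auto simp: parents_def)
qed

lemma parent_not_pendant:
  assumes "v \<in> parents r" "r \<in> pverts T" "v \<noteq> r"
  shows "v \<notin> pendant_vertices T"
proof
  assume "v \<in> pendant_vertices T"
  then have un: "\<exists>!w. (v, w) \<in> parcs T" by (simp add: pendant_iff_unique_neighbour)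
  obtain w where w: "(v, w) \<in> parcs T" "depth r w = Suc (depth r v)"
    using assms(1) by (auto simp: parents_def)
  obtain u where u: "(v, u) \<in> parcs T" "depth r v = Suc (depth r u)"
    using parent_exists[OF _ assms(2,3)] assms(1) by (auto simp: parents_def)
  have "u = w" using un u(1) w(1) by blast
  then show False using u(2) w(2) by simp
qed

lemma root_is_parent:
  assumes "r \<in> pverts T" "card (pverts T) \<ge> 2"
  shows "r \<in> parents r"
proof -
  have "\<not> pverts T \<subseteq> {r}" using assms(2) card_mono[of "{r}" "pverts T"] by auto
  then obtain v where v: "v \<in> pverts T" "v \<noteq> r" by blast
  obtain p where p: "awalk r p v" using walk_exists[OF assms(1) v(1)] by blast
  with v(2) obtain e q where "p = e # q" by (cases p) (auto simp: awalk_Nil_iff)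
  with p obtain w where w: "(r, w) \<in> parcs T" by (cases e) (auto simp: awalk_Cons_iff)
  have "depth r w = Suc (depth r r)"
    using neighbour_depth[OF w assms(1)] depth_root[OF assms(1)] by simp
  then show ?thesis using w assms(1) by (auto simp: parents_def)
qed

text \<open>
  A vertex at maximal distance from an arbitrary root has no child.
\<close>

lemma pendant_exists:
  assumes "card (pverts T) \<ge> 2"
  obtains v where "v \<in> pendant_vertices T"
proof -
  obtain r where r: "r \<in> pverts T" using assms by fastforce
  define m where "m = Max (depth r ` pverts T)"
  have "m \<in> depth r ` pverts T" unfolding m_def using finite_verts r by (intro Max_in) auto
  then obtain v where v: "v \<in> pverts T" "depth r v = m" by auto
  have le: "depth r w \<le> depth r v" if "w \<in> pverts T" for w
    unfolding v(2) m_def using finite_verts that by (intro Max_ge) auto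
  have "v \<notin> parents r" using le in_arcsD2 by (fastforce simp: parents_def)
  then have "v \<noteq> r" using root_is_parent[OF r assms] by auto
  then have "v \<in> pendant_vertices T" using non_pendant_is_parent v(1) r \<open>v \<notin> parents r\<close> by blast
  then show ?thesis by (rule that)
qed

lemma card_parents_pendant_root:
  assumes "r \<in> pendant_vertices T" "card (pverts T) \<ge> 2"
  shows "card (pverts T - pendant_vertices T) + 1 \<le> card (parents r)"
proof -
  have r: "r \<in> pverts T" using assms(1) pendant_subset by blast
  have "insert r (pverts T - pendant_vertices T) \<subseteq> parents r"
    using non_pendant_is_parent[OF _ r] root_is_parent[OF r assms(2)] assms(1) by blast
  moreover have "finite (parents r)" by (simp add: parents_def finite_verts)
  ultimately have "card (insert r (pverts T - pendant_vertices T)) \<le> card (parents r)"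
    by (rule card_mono[rotated])
  then show ?thesis using assms(1) finite_verts by simp
qed

text \<open>
  Two adjacent pendant vertices would form a connected component of their own.
\<close>

lemma pendants_not_adjacent:
  assumes "card (pverts T) \<ge> 3"
    and "x \<in> pendant_vertices T" "y \<in> pendant_vertices T"
  shows "(x, y) \<notin> parcs T"
proof
  assume xy: "(x, y) \<in> parcs T"
  have V: "x \<in> pverts T" "y \<in> pverts T" using xy in_arcsD1 in_arcsD2 by blast+
  have nx: "w = y" if "(x, w) \<in> parcs T" for w
    using that xy assms(2) unfolding pendant_iff_unique_neighbour by blast
  have ny: "w = x" if "(y, w) \<in> parcs T" for w
    using that arcs_symmetric[OF xy] assms(3) unfolding pendant_iff_unique_neighbour by blast
  have "z \<in> {x, y}" if "z \<in> pverts T" for z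
    using that
  proof (induction "depth x z" arbitrary: z rule: less_induct)
    case less
    show ?case
    proof (cases "z = x")
      case False
      then obtain u where u: "(z, u) \<in> parcs T" "depth x z = Suc (depth x u)"
        using parent_exists[OF less.prems V(1)] by blast
      then have "u \<in> {x, y}" using less.hyps in_arcsD2 by simp
      then show ?thesis using nx ny arcs_symmetric[OF u(1)] by blast
    qed simp
  qed
  then have "card (pverts T) \<le> card {x, y}" by (intro card_mono) auto
  then show False using assms(1) card_insert_le_m1[of 2 "{y}" x] by simp
qed

section \<open>The diameter\<close>

text \<open>
  The ancestors of \<open>v\<close> occupy every level above it, and each of them other than the root has
  both a parent and a child, hence is not pendant.
\<close>

lemma depth_le_card_non_pendant:
  assumes "v \<in> pverts T" "r \<in> pverts T"
  shows "depth r v \<le> card (pverts T - pendant_vertices T) + 1"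
proof -
  have ex: "\<exists>u \<in> parents r. depth r u = k" if "k < depth r v" for k
    using that assms(1)
  proof (induction "depth r v - k" arbitrary: v)
    case (Suc j)
    then have "v \<noteq> r" using depth_root[OF assms(2)] by auto
    then obtain u where u: "(v, u) \<in> parcs T" "depth r v = Suc (depth r u)"
      using parent_exists[OF Suc.prems(2) assms(2)] by blast
    have uV: "u \<in> pverts T" using u(1) in_arcsD2 by blast
    show ?case
    proof (cases "depth r u = k")
      case True
      then show ?thesis using u uV arcs_symmetric by (auto simp: parents_def)
    next
      case False
      then show ?thesis using Suc.hyps(1)[of u] Suc.hyps(2) Suc.prems(1) u(2) uV by simp
    qed
  qed simp
  have "{1..<depth r v} \<subseteq> depth r ` (pverts T - pendant_vertices T)"
  proof
    fix k assume k: "k \<in> {1..<depth r v}"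
    then obtain u where u: "u \<in> parents r" "depth r u = k" using ex by auto
    then have "u \<noteq> r" using k depth_root[OF assms(2)] by auto
    then have "u \<in> pverts T - pendant_vertices T"
      using parent_not_pendant[OF u(1) assms(2)] u(1) by (auto simp: parents_def)
    then show "k \<in> depth r ` (pverts T - pendant_vertices T)" using u(2) by blast
  qed
  then have "card {1..<depth r v} \<le> card (pverts T - pendant_vertices T)"
    using finite_verts by (meson surj_card_le finite_Diff)
  then show ?thesis by simp
qed

lemma diameter_le_card_non_pendant:
  assumes "pverts T \<noteq> {}"
  shows "graph_diameter T \<le> card (pverts T - pendant_vertices T) + 1"
proof -
  let ?D = "{graph_dist T u v | u v. u \<in> pverts T \<and> v \<in> pverts T}"
  have "?D = (\<lambda>(u, v). graph_dist T u v) ` (pverts T \<times> pverts T)" by auto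
  then have "finite ?D" "?D \<noteq> {}" using finite_verts assms by simp_all
  then show ?thesis unfolding graph_diameter_def
    using depth_le_card_non_pendant by (subst Max_le_iff) auto
qed

section \<open>Induced matchings\<close>

lemma finite_edges: "finite (edges T)"
proof -
  have "edges T \<subseteq> Pow (pverts T)" using in_arcsD1 in_arcsD2 by (auto simp: edges_def)
  then show ?thesis using finite_verts finite_subset by blast
qed

lemma edge_iff_arc: "{u, v} \<in> edges T \<longleftrightarrow> (u, v) \<in> parcs T"
  using arcs_symmetric by (auto simp: edges_def doubleton_eq_iff)

lemma finite_induced_matching_cards: "finite {card M | M. induced_matching T M}"
proof -
  have "{card M | M. induced_matching T M} \<subseteq> card ` Pow (edges T)"
    by (auto simp: induced_matching_def matching_def)
  then show ?thesis using finite_edges finite_subset by blast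
qed

lemma card_le_indmat: "induced_matching T M \<Longrightarrow> card M \<le> indmat T"
  unfolding indmat_def using finite_induced_matching_cards by (intro Max_ge) auto

lemma maximum_induced_matching:
  obtains M where "induced_matching T M" "card M = indmat T"
proof -
  have "induced_matching T {}" by (simp add: induced_matching_def matching_def)
  then have "indmat T \<in> {card M | M. induced_matching T M}"
    unfolding indmat_def using finite_induced_matching_cards by (intro Max_in) auto
  then show ?thesis using that by force
qed

text \<open>
  Between two of the chosen edges the residues of the depths allow only an arc from the upper
  end of one to the lower end of the other, and the lower end has no second parent.
\<close>

lemma parents_mod_3_le_indmat:
  assumes "r \<in> pverts T"
  shows "card {u \<in> parents r. depth r u mod 3 = c} \<le> indmat T"
proof -
  let ?U = "{u \<in> parents r. depth r u mod 3 = c}"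
  have "\<forall>u \<in> ?U. \<exists>v. (u, v) \<in> parcs T \<and> depth r v = Suc (depth r u)"
    by (auto simp: parents_def)
  from bchoice[OF this] obtain ch
    where "\<forall>u \<in> ?U. (u, ch u) \<in> parcs T \<and> depth r (ch u) = Suc (depth r u)" ..
  then have ch: "(u, ch u) \<in> parcs T" "depth r (ch u) = Suc (depth r u)" if "u \<in> ?U" for u
    using that by blast+
  let ?e = "\<lambda>u. {u, ch u}"
  have mod: "depth r u mod 3 = depth r w mod 3" if "u \<in> ?U" "w \<in> ?U" for u w
    using that by simp
  have parent_eq: "u = w" if "u \<in> ?U" "w \<in> ?U" "(u, ch w) \<in> parcs T" for u w
  proof -
    have "depth r (ch w) = Suc (depth r u)"
      using neighbour_depth[OF that(3) assms] ch(2)[OF that(2)] mod[OF that(1,2)] by presburger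
    \<comment> \<open>both \<open>u\<close> and \<open>w\<close> lie above \<open>ch w\<close>\<close>
    then have "depth r u \<le> depth r (ch w)" "depth r w \<le> depth r (ch w)"
      using ch(2)[OF that(2)] by linarith+
    with arcs_symmetric[OF that(3)] arcs_symmetric[OF ch(1)[OF that(2)]]
    show ?thesis using lower_neighbour_unique[OF assms] by blast
  qed
  have no_arc: "(a, b) \<notin> parcs T"
    if uw: "u \<in> ?U" "w \<in> ?U" "u \<noteq> w" and ab: "a \<in> ?e u" "b \<in> ?e w" for u w a b
  proof
    assume arc: "(a, b) \<in> parcs T"
    note m = mod[OF uw(1,2)]
    have "depth r (ch u) mod 3 = depth r (ch w) mod 3"
      unfolding ch(2)[OF uw(1)] ch(2)[OF uw(2)] using m by (rule mod_Suc_cong_3)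
    then have "\<not> (a = ch u \<and> b = ch w)"
      using neighbour_depth_mod_3[OF arc assms] by auto
    moreover have "\<not> (a = u \<and> b = w)" using neighbour_depth_mod_3[OF arc assms] m by auto
    ultimately show False
      using ab arc parent_eq[OF uw(1,2)] parent_eq[OF uw(2,1)] uw(3) arcs_symmetric by blast
  qed
  have disj: "?e u \<inter> ?e w = {}" if uw: "u \<in> ?U" "w \<in> ?U" "u \<noteq> w" for u w
  proof (rule ccontr)
    have "Suc (depth r w) mod 3 \<noteq> depth r u mod 3" "Suc (depth r u) mod 3 \<noteq> depth r w mod 3"
      using mod[OF uw(1,2)] Suc_mod_3_neq by metis+
    then have "depth r (ch w) \<noteq> depth r u" "depth r (ch u) \<noteq> depth r w"
      unfolding ch(2)[OF uw(1)] ch(2)[OF uw(2)] by metis+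
    then have "u \<noteq> ch w" "ch u \<noteq> w" by auto
    moreover assume "?e u \<inter> ?e w \<noteq> {}"
    ultimately have "ch u = ch w" using uw(3) by blast
    then show False using parent_eq[OF uw(1,2)] ch(1)[OF uw(1)] uw(3) by simp
  qed
  have inj: "inj_on ?e ?U"
  proof (rule inj_onI, rule ccontr)
    fix u w assume "u \<in> ?U" "w \<in> ?U" "?e u = ?e w" "u \<noteq> w"
    then show False using disj[of u w] by simp
  qed
  have "induced_matching T (?e ` ?U)"
    unfolding induced_matching_def matching_def
  proof (intro conjI)
    show "?e ` ?U \<subseteq> edges T" using ch(1) by (auto simp: edge_iff_arc)
  next
    show "\<forall>e \<in> ?e ` ?U. \<forall>f \<in> ?e ` ?U. e \<noteq> f \<longrightarrow> e \<inter> f = {}"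
    proof (intro ballI impI)
      fix e f assume "e \<in> ?e ` ?U" "f \<in> ?e ` ?U" and ne: "e \<noteq> f"
      then obtain u w where u: "e = ?e u" "u \<in> ?U" and w: "f = ?e w" "w \<in> ?U" by blast
      then show "e \<inter> f = {}" using disj[OF u(2) w(2)] ne by metis
    qed
  next
    show "\<forall>e \<in> ?e ` ?U. \<forall>f \<in> ?e ` ?U. e \<noteq> f \<longrightarrow> \<not> (\<exists>u\<in>e. \<exists>v\<in>f. {u, v} \<in> edges T)"
      unfolding edge_iff_arc
    proof (intro ballI impI notI)
      fix e f assume "e \<in> ?e ` ?U" "f \<in> ?e ` ?U" and ne: "e \<noteq> f"
      then obtain u w where u: "e = ?e u" "u \<in> ?U" and w: "f = ?e w" "w \<in> ?U" by blast
      assume "\<exists>a\<in>e. \<exists>b\<in>f. (a, b) \<in> parcs T"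
      then obtain a b where "a \<in> e" "b \<in> f" "(a, b) \<in> parcs T" by blast
      then show False using no_arc[OF u(2) w(2)] ne u(1) w(1) by metis
    qed
  qed
  from card_le_indmat[OF this] show ?thesis using card_image[OF inj] by simp
qed

lemma card_parents_le_3_indmat:
  assumes "r \<in> pverts T"
  shows "card (parents r) \<le> 3 * indmat T"
proof -
  let ?U = "\<lambda>c. {u \<in> parents r. depth r u mod 3 = c}"
  have "parents r = (\<Union>c \<in> {..<3}. ?U c)" by auto
  then have "card (parents r) \<le> (\<Sum>c<3. card (?U c))"
    using card_UN_le[of "{..<3::nat}" ?U] by simp
  also have "\<dots> \<le> (\<Sum>c<3::nat. indmat T)"
    using parents_mod_3_le_indmat[OF assms] by (intro sum_mono)
  finally show ?thesis by simp
qed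

lemma indmat_lower_bound:
  assumes "card (pverts T) \<ge> 2"
  shows "card (pverts T - pendant_vertices T) + 1 \<le> 3 * indmat T"
proof -
  obtain r where r: "r \<in> pendant_vertices T" using pendant_exists[OF assms] .
  then have "r \<in> pverts T" using pendant_subset by blast
  from card_parents_le_3_indmat[OF this] show ?thesis
    using card_parents_pendant_root[OF r assms] by linarith
qed

text \<open>
  Edges of a matching meet \<open>S\<close> in disjoint sets. Counting all vertices and counting the
  non-pendant ones are both instances.
\<close>

lemma card_matching_le:
  assumes "matching T M" and k: "\<And>e. e \<in> edges T \<Longrightarrow> k \<le> card (e \<inter> S)" and "finite S"
  shows "k * card M \<le> card S"
proof -
  have M: "M \<subseteq> edges T" and disj: "\<And>e f. e \<in> M \<Longrightarrow> f \<in> M \<Longrightarrow> e \<noteq> f \<Longrightarrow> e \<inter> f = {}"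
    using assms(1) by (auto simp: matching_def)
  have fin: "finite M" using M finite_edges by (rule finite_subset)
  have "k * card M = (\<Sum>e\<in>M. k)" by simp
  also have "\<dots> \<le> (\<Sum>e\<in>M. card (e \<inter> S))" using k M by (intro sum_mono) auto
  also have "\<dots> = card (\<Union>e\<in>M. e \<inter> S)"
    using fin disj \<open>finite S\<close> by (subst card_UN_disjoint) blast+
  also have "\<dots> \<le> card S" using \<open>finite S\<close> by (intro card_mono) auto
  finally show ?thesis .
qed

lemma twice_indmat_le: "2 * indmat T \<le> card (pverts T)"
proof -
  obtain M where M: "induced_matching T M" "card M = indmat T"
    using maximum_induced_matching .
  have "2 \<le> card (e \<inter> pverts T)" if edge: "e \<in> edges T" for e
  proof -
    obtain u v where e: "e = {u, v}" "(u, v) \<in> parcs T" using edge unfolding edges_def by blast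
    then have "e \<inter> pverts T = {u, v}" using in_arcsD1 in_arcsD2 by auto
    then show ?thesis using no_loops'[OF e(2)] by simp
  qed
  then show ?thesis
    using card_matching_le[of M 2 "pverts T"] M finite_verts by (simp add: induced_matching_def)
qed

lemma indmat_le_non_pendant:
  assumes "card (pverts T) \<ge> 3"
  shows "indmat T \<le> card (pverts T - pendant_vertices T)"
proof -
  obtain M where M: "induced_matching T M" "card M = indmat T"
    using maximum_induced_matching .
  let ?I = "pverts T - pendant_vertices T"
  have "1 \<le> card (e \<inter> ?I)" if edge: "e \<in> edges T" for e
  proof -
    obtain u v where e: "e = {u, v}" "(u, v) \<in> parcs T" using edge unfolding edges_def by blast
    have "u \<notin> pendant_vertices T \<or> v \<notin> pendant_vertices T"
      using pendants_not_adjacent[OF assms] e(2) by blast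
    then have "e \<inter> ?I \<noteq> {}"
      using in_arcsD1[OF e(2)] in_arcsD2[OF e(2)] unfolding e(1) by blast
    moreover have "finite (e \<inter> ?I)" using finite_verts by simp
    ultimately show ?thesis by (simp add: Suc_le_eq card_gt_0_iff)
  qed
  then show ?thesis
    using card_matching_le[of M 1 ?I] M finite_verts by (simp add: induced_matching_def)
qed

end

section \<open>The bounds on the induced matching number\<close>

theorem corollary3p4:
  fixes T :: "'a pair_pre_digraph" and n d p :: nat
  assumes "tree_graph T"
    and "n = card (pverts T)" and "n \<ge> 2"
    and "d = graph_diameter T"
    and "p = num_pendant T"
  shows "\<lfloor>(real n - real p + real d + 5) / 6\<rfloor> \<le> int (indmat T)
    \<and> int (indmat T) \<le> min (int n - int p) \<lfloor>(2 * real n - real p) / 3\<rfloor>"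
proof -
  interpret undirected_tree T
    using assms(1) unfolding tree_graph_def
    by (intro undirected_tree.intro undirected_tree_axioms.intro) blast+
  define q where "q = card (pverts T - pendant_vertices T)"
  define m where "m = indmat T"
  have q: "q = n - card (pendant_vertices T)" and pn: "card (pendant_vertices T) \<le> n"
    unfolding q_def assms(2)
    using card_Diff_subset[OF finite_subset[OF pendant_subset finite_verts] pendant_subset]
      card_mono[OF finite_verts pendant_subset] by blast+
  have three_m: "q + 1 \<le> 3 * m"
    using indmat_lower_bound assms(2,3) by (simp add: q_def m_def)
  have "pverts T \<noteq> {}" using assms(2,3) by auto
  then have d: "d \<le> q + 1"
    using diameter_le_card_non_pendant assms(4) by (simp add: q_def)
  have two_m: "2 * m \<le> n" using twice_indmat_le assms(2) by (simp add: m_def)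
  \<comment> \<open>for \<open>n = 2\<close> the convention \<open>p = 1\<close> makes \<open>p\<close> differ from the number of pendant vertices\<close>
  have np: "n - p \<le> q + 1 \<and> p \<le> n \<and> m \<le> n - p \<and> n + d \<le> 6 * m + p"
  proof (cases "n = 2")
    case True
    obtain r where "r \<in> pendant_vertices T" using pendant_exists assms(2,3) by auto
    then have "card (pendant_vertices T) > 0"
      using finite_subset[OF pendant_subset finite_verts] by (auto simp: card_gt_0_iff)
    moreover have "p = 1" using True assms(2,5) by (simp add: num_pendant_def)
    ultimately show ?thesis using True q d two_m three_m by auto
  next
    case False
    then have "p = card (pendant_vertices T)" using assms(2,5) by (simp add: num_pendant_def)
    moreover have "m \<le> q"
      using indmat_le_non_pendant False assms(2,3) by (simp add: q_def m_def)
    ultimately show ?thesis using q pn d three_m by linarith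
  qed
  have "\<lfloor>(real n - real p + real d + 5) / 6\<rfloor> \<le> int m"
  proof -
    \<comment> \<open>the summand 5 only rounds up the quotient by 6\<close>
    have "real n + real d \<le> 6 * real m + real p" using np by linarith
    then have "(real n - real p + real d + 5) / 6 < real m + 1" by (simp add: field_simps)
    then show ?thesis by (simp add: floor_le_iff)
  qed
  moreover have "int m \<le> int n - int p" using np by linarith
  moreover have "int m \<le> \<lfloor>(2 * real n - real p) / 3\<rfloor>"
  proof -
    have "3 * m + p \<le> 2 * n" using np two_m by linarith
    then have "3 * real m + real p \<le> 2 * real n" by linarith
    then show ?thesis by (simp add: le_floor_iff field_simps)
  qed
  ultimately show ?thesis by (simp add: m_def)
qed

end
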